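(* (Affine covariance type property.) Let $T(x)=(px+q)s^{-1}$ be an affine transformation on $\mathcal A$, let $\Xi\subset\mathcal A$ be such that $T(\Xi)=J_a^b$, and let $y\in\Xi$ be the fixed base point. Put $A_T=\psi_3\frac{\overline p}{|p|}\overline\psi_3$ and $B_T=|s^{-1}|\,\overline p$. If $f\in AC^1(J_a^b,\mathbb H)$, then for $x\in\Xi$ and $\xi=T(x)$, $${}_a^{\psi}\overline\partial_x^{\alpha,\sigma,\varphi,T}[A_Tf](x,y)\,e^{\sum_{k=0}^2\lambda_k\circ T(x)}=\beta_T(x)\;{}_a^{\psi}\overline\partial_\xi^{\alpha,\sigma,\varphi}[f](\xi,T(y))\,e^{\sum_{k=0}^2\lambda_k(\xi)},$$ where $\beta_T(x)=B_T\,D\varphi(\xi,T(y))\,\sigma^{-1}$.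
   Context: Quaternions and structural set. $\mathbb H$ is the skew-field of real quaternions with standard basis $\mathbf e_0=1,\mathbf e_1,\mathbf e_2,\mathbf e_3$, conjugation $q\mapsto\overline q$ and norm $|q|$. $\psi=\{\psi_0,\psi_1,\psi_2\}\subset\mathrm{span}_{\mathbb R}\{\mathbf e_0,\mathbf e_1,\mathbf e_2\}$ is a structural set, i.e. it is orthonormal: $\psi_k\overline\psi_s+\psi_s\overline\psi_k=2\delta_{k,s}$; by convention $\psi_0=1$. $\psi_3$ is a unit vector such that $\{\psi_0,\psi_1,\psi_2,\psi_3\}$ is an orthonormal basis of $\mathbb H$ and $\{\psi_1,\psi_2,\psi_3\}$ is cooriented with $\{\mathbf e_1,\mathbf e_2,\mathbf e_3\}$. $\mathcal A=\mathrm{span}_{\mathbb R}\{\psi_0,\psi_1,\psi_2\}\cong\mathbb R^3$, $x=\sum_{k=0}^2x_k\psi_k$. $\mathbb H$-valued functions are written $f=\sum_{k=0}^3f_k\psi_k$ with $f_k$ real valued. The left $\psi$-Cauchy-Riemann operator is ${}^{\psi}\overline\partial f=\sum_{k=0}^2\psi_k\,\partial f/\partial x_k$; a subscript indicates the variable of differentiation. Affine transformations. An affine transformation on $\mathcal A$ (a finite composition of translations, positive dilations and rotations) is a map $T(x)=(px+q)s^{-1}$ with $p,q,s\in\mathbb H$, $p,s\neq0$, $qs^{-1}\in\mathcal A$ and $\frac{s^{-1}}{|s^{-1}|}=\psi_3\frac{\overline p}{|p|}\overline\psi_3$. Fractional data. $a=\sum_{k=0}^2\psi_ka_k$, $b=\sum_{k=0}^2\psi_kb_k$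 with $a_k<b_k$, and $J_a^b=\{\sum_{k=0}^2\psi_kx_k: a_k<x_k<b_k\}$. $\sigma=\sum_{k=0}^2\psi_k\sigma_k$ with $0<\sigma_k<1$; $\alpha=(\alpha_0,\alpha_1,\alpha_2)\in\mathbb C^3$ with $0<\Re\alpha_k<1$; $1-\alpha=(1-\alpha_0,1-\alpha_1,1-\alpha_2)$. (For non-real $\alpha_k$, values are taken in $\mathbb C\otimes\mathbb H$, the complex unit commuting with the $\psi_k$.) A point $y\in\Xi$ is fixed and $\zeta:=T(y)\in J_a^b$. $\varphi\in C^1(\overline{J_a^b},\mathbb R)$ satisfies $\frac{\partial}{\partial\xi_i}\varphi(\zeta_0,\dots,\xi_i,\dots,\zeta_2)>0$ for all $\xi_i\in[a_i,b_i]$, $i=0,1,2$ (only the $i$-th coordinate of $\zeta$ is replaced by $\xi_i$). Put $\varphi_i(\xi_i)=\varphi(\zeta_0,\dots,\xi_i,\dots,\zeta_2)$ and $D\varphi(\xi,\zeta)=\sum_{i=0}^2\frac{\partial}{\partial\xi_i}\varphi(\zeta_0,\dots,\xi_i,\dots,\zeta_2)$. $AC^1(J_a^b,\mathbb H)$ is the set of $f=\sum_{i=0}^3\psi_if_i$ such that every map $x_j\mapsto f_i(w_0,\dots,x_j,\dots,w_2)$ belongs to $AC^1((a_j,b_j),\mathbb R)$ for all $w\in J_a^b$, $j=0,1,2$, $i=0,\dots,3$, where $AC^1$ in one variable is the usual class of absolutely continuous functions of fractional calculus. For a one-variable function $u$, $0<\Re\beta<1$ and $\rho\in(0,1)$,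 $$({}_{a_i}I^{\beta,\rho,\varphi_i}u)(t)=\frac1{\rho^\beta\Gamma(\beta)}\int_{a_i}^te^{\frac{\rho-1}{\rho}(\varphi_i(t)-\varphi_i(\tau))}(\varphi_i(t)-\varphi_i(\tau))^{\beta-1}u(\tau)\varphi_i'(\tau)\,d\tau.$$ For $\mathbb H$-valued $f$ on $J_a^b$ and $\beta=(\beta_0,\beta_1,\beta_2)$, $${}_aI^{\beta,\sigma,\varphi}[f](\xi,\zeta)=\sum_{i=0}^2({}_{a_i}I^{\beta_i,\sigma_i,\varphi_i}f)(\zeta_0,\dots,\xi_i,\dots,\zeta_2),$$ the $i$-th integral acting on the $i$-th variable. Standing assumption: there are $\lambda_0,\lambda_1,\lambda_2\in C^1(\overline{J_a^b},\mathbb R)$ with ${}^{\psi}\overline\partial_\xi\left[\sum_{k=0}^2\lambda_k(\xi)\right]=D\varphi(\xi,\zeta)\,\sigma^{-1}(1-\sigma)$; these are the $\lambda_k$ used. The left fractional proportional $\psi$-Cauchy-Riemann type operator is $${}_a^{\psi}\overline\partial_\xi^{\alpha,\sigma,\varphi}[f](\xi,\zeta)=(1-\sigma)\,{}_aI^{1-\alpha,\sigma,\varphi}[f](\xi,\zeta)+\sigma\,\frac{{}^{\psi}\overline\partial_\xi\big({}_aI^{1-\alpha,\sigma,\varphi}[f](\xi,\zeta)\big)}{D\varphi(\xi,\zeta)},$$ and the operator associated with $T$ is $${}_a^{\psi}\overline\partial_x^{\alpha,\sigma,\varphi,T}[g](x,y)={}^{\psi}\overline\partial_x\Big[\sum_{k=0}^2\lambda_k\circ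 T(x)\Big]\,{}_aI^{1-\alpha,\sigma,\varphi}[g](T(x),T(y))+{}^{\psi}\overline\partial_x\Big({}_aI^{1-\alpha,\sigma,\varphi}[g](T(x),T(y))\Big).$$ *)

theory Defs
  imports "HOL-Analysis.Analysis"
begin

section \<open>Quaternions over a commutative coefficient ring\<close>

datatype 'a quat = Quat (re: 'a) (im1: 'a) (im2: 'a) (im3: 'a)

text \<open>
  \<^typ>\<open>real quat\<close> is the skew-field of real quaternions; \<^typ>\<open>complex quat\<close> is its
  complexification, in which the complex unit commutes with the quaternionic units.
\<close>

lemma quat_eqI:
  "re x = re y \<Longrightarrow> im1 x = im1 y \<Longrightarrow> im2 x = im2 y \<Longrightarrow> im3 x = im3 y \<Longrightarrow> x = y"
  by (cases x; cases y) simp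

lemma quat_eq_iff:
  "x = y \<longleftrightarrow> re x = re y \<and> im1 x = im1 y \<and> im2 x = im2 y \<and> im3 x = im3 y"
  by (cases x; cases y) simp

instantiation quat :: (ab_group_add) ab_group_add
begin

definition zero_quat :: "'a quat" where
  "0 = Quat 0 0 0 0"

definition plus_quat :: "'a quat \<Rightarrow> 'a quat \<Rightarrow> 'a quat" where
  "x + y = Quat (re x + re y) (im1 x + im1 y) (im2 x + im2 y) (im3 x + im3 y)"

definition minus_quat :: "'a quat \<Rightarrow> 'a quat \<Rightarrow> 'a quat" where
  "x - y = Quat (re x - re y) (im1 x - im1 y) (im2 x - im2 y) (im3 x - im3 y)"

definition uminus_quat :: "'a quat \<Rightarrow> 'a quat" where
  "- x = Quat (- re x) (- im1 x) (- im2 x) (- im3 x)"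

instance
  by standard
    (simp_all add: zero_quat_def plus_quat_def minus_quat_def uminus_quat_def quat_eq_iff add.assoc
      add.commute)

end

lemma quat_zero_sel [simp]: "re 0 = 0" "im1 0 = 0" "im2 0 = 0" "im3 0 = 0"
  by (simp_all add: zero_quat_def)

lemma quat_plus_sel [simp]:
  "re (x + y) = re x + re y" "im1 (x + y) = im1 x + im1 y"
  "im2 (x + y) = im2 x + im2 y" "im3 (x + y) = im3 x + im3 y"
  by (simp_all add: plus_quat_def)

lemma quat_minus_sel [simp]:
  "re (x - y) = re x - re y" "im1 (x - y) = im1 x - im1 y"
  "im2 (x - y) = im2 x - im2 y" "im3 (x - y) = im3 x - im3 y"
  by (simp_all add: minus_quat_def)

lemma quat_uminus_sel [simp]:
  "re (- x) = - re x" "im1 (- x) = - im1 x" "im2 (- x) = - im2 x" "im3 (- x) = - im3 x"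
  by (simp_all add: uminus_quat_def)

instantiation quat :: (comm_ring_1) ring_1
begin

definition one_quat :: "'a quat" where
  "1 = Quat 1 0 0 0"

definition times_quat :: "'a quat \<Rightarrow> 'a quat \<Rightarrow> 'a quat" where
  "x * y = Quat
     (re x * re y - im1 x * im1 y - im2 x * im2 y - im3 x * im3 y)
     (re x * im1 y + im1 x * re y + im2 x * im3 y - im3 x * im2 y)
     (re x * im2 y - im1 x * im3 y + im2 x * re y + im3 x * im1 y)
     (re x * im3 y + im1 x * im2 y - im2 x * im1 y + im3 x * re y)"

instance
  by standard (simp_all add: one_quat_def times_quat_def quat_eq_iff algebra_simps)

end

lemma quat_one_sel [simp]: "re 1 = 1" "im1 1 = 0" "im2 1 = 0" "im3 1 = 0"
  by (simp_all add: one_quat_def)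

lemma quat_times_sel [simp]:
  "re (x * y) = re x * re y - im1 x * im1 y - im2 x * im2 y - im3 x * im3 y"
  "im1 (x * y) = re x * im1 y + im1 x * re y + im2 x * im3 y - im3 x * im2 y"
  "im2 (x * y) = re x * im2 y - im1 x * im3 y + im2 x * re y + im3 x * im1 y"
  "im3 (x * y) = re x * im3 y + im1 x * im2 y - im2 x * im1 y + im3 x * re y"
  by (simp_all add: times_quat_def)

definition qcnj :: "'a::ab_group_add quat \<Rightarrow> 'a quat" where
  "qcnj x = Quat (re x) (- im1 x) (- im2 x) (- im3 x)"

definition qscalar :: "'a::zero \<Rightarrow> 'a quat" where
  "qscalar c = Quat c 0 0 0"

definition complexify :: "real quat \<Rightarrow> complex quat" where
  "complexify = map_quat complex_of_real"

abbreviation qe1 :: "real quat" where "qe1 \<equiv> Quat 0 1 0 0"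
abbreviation qe2 :: "real quat" where "qe2 \<equiv> Quat 0 0 1 0"

instantiation quat :: (field) inverse
begin

definition inverse_quat :: "'a quat \<Rightarrow> 'a quat" where
  "inverse x = qscalar (inverse ((re x)^2 + (im1 x)^2 + (im2 x)^2 + (im3 x)^2)) * qcnj x"

definition divide_quat :: "'a quat \<Rightarrow> 'a quat \<Rightarrow> 'a quat" where
  "x div y = x * inverse (y :: 'a quat)"

instance ..

end

instance quat :: (linordered_field) division_ring
proof
  fix x y :: "'a quat"
  have sq: "(re x)^2 + (im1 x)^2 + (im2 x)^2 + (im3 x)^2 \<noteq> 0" if "x \<noteq> 0"
  proof
    assume "(re x)^2 + (im1 x)^2 + (im2 x)^2 + (im3 x)^2 = 0"
    moreover have "(re x)^2 \<ge> 0" "(im1 x)^2 \<ge> 0" "(im2 x)^2 \<ge> 0" "(im3 x)^2 \<ge> 0"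
      by simp_all
    ultimately have "(re x)^2 = 0" "(im1 x)^2 = 0" "(im2 x)^2 = 0" "(im3 x)^2 = 0"
      by linarith+
    with that show False by (simp add: quat_eq_iff)
  qed
  define n where "n = (re x)^2 + (im1 x)^2 + (im2 x)^2 + (im3 x)^2"
  have inv: "inverse x = qscalar (inverse n) * qcnj x"
    by (simp add: inverse_quat_def n_def)
  have l: "inverse x * x = qscalar (inverse n * n)" "x * inverse x = qscalar (inverse n * n)"
    unfolding inv by (simp_all add: quat_eq_iff qscalar_def qcnj_def n_def power2_eq_square
        algebra_simps)
  show "inverse x * x = 1" "x * inverse x = 1" if "x \<noteq> 0"
    using sq[OF that] unfolding l by (simp_all add: n_def qscalar_def one_quat_def)
  show "x / y = x * inverse y"
    by (simp add: divide_quat_def)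
  show "inverse (0 :: 'a quat) = 0"
    by (simp add: inverse_quat_def quat_eq_iff qscalar_def qcnj_def)
qed

instantiation quat :: (real_vector) real_vector
begin

definition scaleR_quat :: "real \<Rightarrow> 'a quat \<Rightarrow> 'a quat" where
  "r *\<^sub>R x = Quat (r *\<^sub>R re x) (r *\<^sub>R im1 x) (r *\<^sub>R im2 x) (r *\<^sub>R im3 x)"

instance
  by standard (simp_all add: scaleR_quat_def quat_eq_iff scaleR_add_left scaleR_add_right)

end

lemma quat_scaleR_sel [simp]:
  "re (r *\<^sub>R x) = r *\<^sub>R re x" "im1 (r *\<^sub>R x) = r *\<^sub>R im1 x"
  "im2 (r *\<^sub>R x) = r *\<^sub>R im2 x" "im3 (r *\<^sub>R x) = r *\<^sub>R im3 x"
  by (simp_all add: scaleR_quat_def)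

instance quat :: ("{comm_ring_1, real_algebra_1}") real_algebra_1
  by standard (simp_all add: quat_eq_iff algebra_simps)

instantiation quat :: (real_normed_vector) real_normed_vector
begin

definition norm_quat :: "'a quat \<Rightarrow> real" where
  "norm x = sqrt ((norm (re x))^2 + (norm (im1 x))^2 + (norm (im2 x))^2 + (norm (im3 x))^2)"

definition dist_quat :: "'a quat \<Rightarrow> 'a quat \<Rightarrow> real" where
  "dist x y = norm (x - y :: 'a quat)"

definition sgn_quat :: "'a quat \<Rightarrow> 'a quat" where
  "sgn x = x /\<^sub>R norm (x :: 'a quat)"

definition uniformity_quat :: "('a quat \<times> 'a quat) filter" where
  "uniformity_quat = (INF e\<in>{0 <..}. principal {(x :: 'a quat, y). dist x y < e})"

definition open_quat :: "'a quat set \<Rightarrow> bool" where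
  "open_quat U \<longleftrightarrow> (\<forall>x\<in>U. eventually (\<lambda>(x', y). x' = x \<longrightarrow> y \<in> U) uniformity)"

instance
proof
  fix x y :: "'a quat" and r :: real
  define P where "P = (\<lambda>z :: 'a quat. ((re z, im1 z), (im2 z, im3 z)))"
  have P: "norm z = norm (P z)" for z
    by (simp add: norm_quat_def P_def norm_Pair)
  have "P (x + y) = P x + P y" "P (r *\<^sub>R x) = r *\<^sub>R P x" "P x = 0 \<longleftrightarrow> x = 0"
    by (simp_all add: P_def zero_prod_def quat_eq_iff)
  then show "norm (x + y) \<le> norm x + norm y" "norm (r *\<^sub>R x) = \<bar>r\<bar> * norm x"
    "norm x = 0 \<longleftrightarrow> x = 0"
    by (simp_all add: P norm_triangle_ineq)
qed (simp_all add: dist_quat_def sgn_quat_def uniformity_quat_def open_quat_def)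

end

instantiation quat :: (real_inner) real_inner
begin

definition inner_quat :: "'a quat \<Rightarrow> 'a quat \<Rightarrow> real" where
  "x \<bullet> y = re x \<bullet> re y + im1 x \<bullet> im1 y + im2 x \<bullet> im2 y + im3 x \<bullet> im3 y"

instance
proof
  fix x y z :: "'a quat" and r :: real
  show "x \<bullet> y = y \<bullet> x" by (simp add: inner_quat_def inner_commute)
  show "(x + y) \<bullet> z = x \<bullet> z + y \<bullet> z" by (simp add: inner_quat_def inner_add_left)
  show "(r *\<^sub>R x) \<bullet> y = r * (x \<bullet> y)" by (simp add: inner_quat_def algebra_simps)
  show "0 \<le> x \<bullet> x" by (simp add: inner_quat_def)
  show "(x \<bullet> x = 0) = (x = 0)"
    by (simp add: inner_quat_def quat_eq_iff add_nonneg_eq_0_iff conj_assoc)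
  show "norm x = sqrt (x \<bullet> x)"
    by (simp add: norm_quat_def inner_quat_def power2_norm_eq_inner)
qed

end

instantiation quat :: (euclidean_space) euclidean_space
begin

definition Basis_quat :: "'a quat set" where
  "Basis = (\<lambda>u. Quat u 0 0 0) ` Basis \<union> (\<lambda>u. Quat 0 u 0 0) ` Basis
         \<union> (\<lambda>u. Quat 0 0 u 0) ` Basis \<union> (\<lambda>u. Quat 0 0 0 u) ` Basis"

instance
proof
  show "(Basis :: 'a quat set) \<noteq> {}" "finite (Basis :: 'a quat set)"
    by (simp_all add: Basis_quat_def)
  fix u v :: "'a quat"
  show "u \<in> Basis \<Longrightarrow> v \<in> Basis \<Longrightarrow> u \<bullet> v = (if u = v then 1 else 0)"
    by (auto simp: Basis_quat_def inner_quat_def inner_Basis split: if_splits)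
next
  fix u :: "'a quat"
  show "(\<forall>v\<in>Basis. u \<bullet> v = 0) = (u = 0)"
    by (simp add: Basis_quat_def inner_quat_def ball_Un quat_eq_iff euclidean_all_zero_iff)
qed

end

section \<open>Structural sets and coordinates\<close>

definition structural_set :: "(nat \<Rightarrow> real quat) \<Rightarrow> bool" where
  "structural_set \<psi> \<longleftrightarrow>
     (\<forall>k<3. \<psi> k \<in> span {1, qe1, qe2}) \<and>
     (\<forall>k<3. \<forall>s<3. \<psi> k * qcnj (\<psi> s) + \<psi> s * qcnj (\<psi> k) = (if k = s then 2 else 0))"

definition orthonormal_quat_basis :: "(nat \<Rightarrow> real quat) \<Rightarrow> bool" where
  "orthonormal_quat_basis \<psi> \<longleftrightarrow>
     (\<forall>k\<le>3. \<forall>s\<le>3. \<psi> k \<bullet> \<psi> s = (if k = s then 1 else 0)) \<and> span (\<psi> ` {..3}) = UNIV"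

definition imag :: "real quat \<Rightarrow> real ^ 3" where
  "imag x = vector [im1 x, im2 x, im3 x]"

definition cooriented :: "(nat \<Rightarrow> real quat) \<Rightarrow> bool" where
  "cooriented \<psi> \<longleftrightarrow> det (vector [imag (\<psi> 1), imag (\<psi> 2), imag (\<psi> 3)] :: real ^ 3 ^ 3) > 0"

definition psi_space :: "(nat \<Rightarrow> real quat) \<Rightarrow> real quat set" where
  "psi_space \<psi> = span (\<psi> ` {..<3})"

definition psi_point :: "(nat \<Rightarrow> real quat) \<Rightarrow> (nat \<Rightarrow> real) \<Rightarrow> real quat" where
  "psi_point \<psi> c = (\<Sum>k<3. c k *\<^sub>R \<psi> k)"

text \<open>Coefficients with respect to an orthonormal \<open>\<psi>\<close>.\<close>

definition psi_coord :: "(nat \<Rightarrow> real quat) \<Rightarrow> real quat \<Rightarrow> nat \<Rightarrow> real" where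
  "psi_coord \<psi> x k = x \<bullet> \<psi> k"

text \<open>The point obtained from \<open>x\<close> by replacing its \<open>i\<close>-th coordinate with \<open>t\<close>.\<close>

definition psi_subst :: "(nat \<Rightarrow> real quat) \<Rightarrow> real quat \<Rightarrow> nat \<Rightarrow> real \<Rightarrow> real quat" where
  "psi_subst \<psi> x i t = psi_point \<psi> ((psi_coord \<psi> x)(i := t))"

definition psi_box :: "(nat \<Rightarrow> real quat) \<Rightarrow> (nat \<Rightarrow> real) \<Rightarrow> (nat \<Rightarrow> real) \<Rightarrow> real quat set" where
  "psi_box \<psi> a b = {psi_point \<psi> c | c. \<forall>k<3. a k < c k \<and> c k < b k}"

section \<open>Function classes\<close>

text \<open>
  Partial derivatives at boundary points of the closed box are one-sided.
\<close>

definition C1_closed_box ::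
    "(nat \<Rightarrow> real quat) \<Rightarrow> (nat \<Rightarrow> real) \<Rightarrow> (nat \<Rightarrow> real) \<Rightarrow> (real quat \<Rightarrow> real) \<Rightarrow> bool" where
  "C1_closed_box \<psi> a b g \<longleftrightarrow>
     continuous_on (closure (psi_box \<psi> a b)) g \<and>
     (\<forall>k<3. \<exists>d. continuous_on (closure (psi_box \<psi> a b)) d \<and>
        (\<forall>x\<in>closure (psi_box \<psi> a b).
           ((\<lambda>t. g (psi_subst \<psi> x k t)) has_real_derivative d x)
             (at (psi_coord \<psi> x k) within {a k..b k})))"

definition abs_cont_on :: "real set \<Rightarrow> (real \<Rightarrow> real) \<Rightarrow> bool" where
  "abs_cont_on S u \<longleftrightarrow>
     (\<forall>\<epsilon>>0. \<exists>\<delta>>0. \<forall>D :: (real \<times> real) set.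
        finite D \<longrightarrow> (\<forall>(c, d)\<in>D. c < d \<and> {c..d} \<subseteq> S) \<longrightarrow>
        disjoint_family_on (\<lambda>(c, d). {c<..<d}) D \<longrightarrow>
        (\<Sum>(c, d)\<in>D. d - c) < \<delta> \<longrightarrow> (\<Sum>(c, d)\<in>D. \<bar>u d - u c\<bar>) < \<epsilon>)"

definition AC1_box ::
    "(nat \<Rightarrow> real quat) \<Rightarrow> (nat \<Rightarrow> real) \<Rightarrow> (nat \<Rightarrow> real) \<Rightarrow> (real quat \<Rightarrow> real quat) \<Rightarrow> bool" where
  "AC1_box \<psi> a b f \<longleftrightarrow>
     (\<forall>w\<in>psi_box \<psi> a b. \<forall>j<3. \<forall>i\<le>3.
        abs_cont_on {a j<..<b j} (\<lambda>t. psi_coord \<psi> (f (psi_subst \<psi> w j t)) i))"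

section \<open>Operators\<close>

text \<open>
  The left Cauchy-Riemann operator on functions on \<^const>\<open>psi_space\<close>; its value is 0 where the
  function is not (totally) differentiable. A convention is needed because a fractional integral of
  an absolutely continuous function need not be differentiable at every point. For a sum of
  functions of one coordinate each, as the fractional integrals below, total differentiability is
  the same as existence of the partial derivatives, but the latter is not invariant under rotations
  of the argument. Real-valued functions enter as scalar quaternion-valued ones through
  \<^const>\<open>of_real\<close>.
\<close>

definition cauchy_riemann ::
    "(nat \<Rightarrow> real quat) \<Rightarrow> (real quat \<Rightarrow> complex quat) \<Rightarrow> real quat \<Rightarrow> complex quat" where
  "cauchy_riemann \<psi> F x =
     (if F differentiable (at x within psi_space \<psi>)
      then \<Sum>k<3. complexify (\<psi> k) *
             vector_derivative (\<lambda>t. F (psi_subst \<psi> x k t)) (at (psi_coord \<psi> x k))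
      else 0)"

text \<open>
  The derivative of \<open>\<phi>\<^sub>i\<close>, that is, of \<open>\<phi>\<close> along the \<open>i\<close>-th coordinate line through \<open>\<zeta>\<close>,
  one-sided at the endpoints.
\<close>

definition phi_deriv ::
    "(nat \<Rightarrow> real quat) \<Rightarrow> (nat \<Rightarrow> real) \<Rightarrow> (nat \<Rightarrow> real) \<Rightarrow> (real quat \<Rightarrow> real)
     \<Rightarrow> real quat \<Rightarrow> nat \<Rightarrow> real \<Rightarrow> real" where
  "phi_deriv \<psi> a b \<phi> \<zeta> i t =
     vector_derivative (\<lambda>\<tau>. \<phi> (psi_subst \<psi> \<zeta> i \<tau>)) (at t within {a i..b i})"

definition Dphi ::
    "(nat \<Rightarrow> real quat) \<Rightarrow> (nat \<Rightarrow> real) \<Rightarrow> (nat \<Rightarrow> real) \<Rightarrow> (real quat \<Rightarrow> real)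
     \<Rightarrow> real quat \<Rightarrow> real quat \<Rightarrow> real" where
  "Dphi \<psi> a b \<phi> \<xi> \<zeta> = (\<Sum>i<3. phi_deriv \<psi> a b \<phi> \<zeta> i (psi_coord \<psi> \<xi> i))"

text \<open>
  One-variable proportional fractional integral with respect to \<open>\<Phi>\<close>, of order \<open>\<beta>\<close>, proportion
  \<open>\<rho>\<close> and lower limit \<open>l\<close>.
\<close>

definition frac_integral ::
    "real \<Rightarrow> complex \<Rightarrow> real \<Rightarrow> (real \<Rightarrow> real) \<Rightarrow> (real \<Rightarrow> real quat) \<Rightarrow> real \<Rightarrow> complex quat" where
  "frac_integral l \<beta> \<rho> \<Phi> u t =
     qscalar (1 / (complex_of_real \<rho> powr \<beta> * Gamma \<beta>)) *
     (LINT \<tau>:{l<..<t}|lborel.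
        qscalar (complex_of_real (exp ((\<rho> - 1) / \<rho> * (\<Phi> t - \<Phi> \<tau>))) *
                 complex_of_real (\<Phi> t - \<Phi> \<tau>) powr (\<beta> - 1)) *
        complexify (u \<tau>) * of_real (deriv \<Phi> \<tau>))"

definition frac_integral3 ::
    "(nat \<Rightarrow> real quat) \<Rightarrow> (nat \<Rightarrow> real) \<Rightarrow> (nat \<Rightarrow> complex) \<Rightarrow> (nat \<Rightarrow> real) \<Rightarrow> (real quat \<Rightarrow> real)
     \<Rightarrow> (real quat \<Rightarrow> real quat) \<Rightarrow> real quat \<Rightarrow> real quat \<Rightarrow> complex quat" where
  "frac_integral3 \<psi> a \<beta> \<sigma> \<phi> f \<xi> \<zeta> =
     (\<Sum>i<3. frac_integral (a i) (\<beta> i) (\<sigma> i) (\<lambda>t. \<phi> (psi_subst \<psi> \<zeta> i t))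
               (\<lambda>t. f (psi_subst \<psi> \<zeta> i t)) (psi_coord \<psi> \<xi> i))"

definition frac_CR ::
    "(nat \<Rightarrow> real quat) \<Rightarrow> (nat \<Rightarrow> real) \<Rightarrow> (nat \<Rightarrow> real) \<Rightarrow> (nat \<Rightarrow> complex) \<Rightarrow> (nat \<Rightarrow> real)
     \<Rightarrow> (real quat \<Rightarrow> real) \<Rightarrow> (real quat \<Rightarrow> real quat) \<Rightarrow> real quat \<Rightarrow> real quat \<Rightarrow> complex quat"
  where
  "frac_CR \<psi> a b \<alpha> \<sigma> \<phi> f \<xi> \<zeta> =
     complexify (1 - psi_point \<psi> \<sigma>) * frac_integral3 \<psi> a (\<lambda>i. 1 - \<alpha> i) \<sigma> \<phi> f \<xi> \<zeta> +
     complexify (psi_point \<psi> \<sigma>) *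
       (cauchy_riemann \<psi> (\<lambda>\<eta>. frac_integral3 \<psi> a (\<lambda>i. 1 - \<alpha> i) \<sigma> \<phi> f \<eta> \<zeta>) \<xi>
          /\<^sub>R Dphi \<psi> a b \<phi> \<xi> \<zeta>)"

definition frac_CR_affine ::
    "(nat \<Rightarrow> real quat) \<Rightarrow> (nat \<Rightarrow> real) \<Rightarrow> (nat \<Rightarrow> complex) \<Rightarrow> (nat \<Rightarrow> real)
     \<Rightarrow> (real quat \<Rightarrow> real) \<Rightarrow> (nat \<Rightarrow> real quat \<Rightarrow> real) \<Rightarrow> (real quat \<Rightarrow> real quat)
     \<Rightarrow> (real quat \<Rightarrow> real quat) \<Rightarrow> real quat \<Rightarrow> real quat \<Rightarrow> complex quat" where
  "frac_CR_affine \<psi> a \<alpha> \<sigma> \<phi> \<Lambda> T g x y =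
     cauchy_riemann \<psi> (\<lambda>z. of_real (\<Sum>k<3. \<Lambda> k (T z))) x *
       frac_integral3 \<psi> a (\<lambda>i. 1 - \<alpha> i) \<sigma> \<phi> g (T x) (T y) +
     cauchy_riemann \<psi> (\<lambda>z. frac_integral3 \<psi> a (\<lambda>i. 1 - \<alpha> i) \<sigma> \<phi> g (T z) (T y)) x"

section \<open>Affine transformations\<close>

definition affine_transformation ::
    "(nat \<Rightarrow> real quat) \<Rightarrow> real quat \<Rightarrow> real quat \<Rightarrow> real quat \<Rightarrow> (real quat \<Rightarrow> real quat) \<Rightarrow> bool"
  where
  "affine_transformation \<psi> p q s T \<longleftrightarrow>
     p \<noteq> 0 \<and> s \<noteq> 0 \<and> q * inverse s \<in> psi_space \<psi> \<and>
     inverse s /\<^sub>R norm (inverse s) = \<psi> 3 * (qcnj p /\<^sub>R norm p) * qcnj (\<psi> 3) \<and>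
     T = (\<lambda>x. (p * x + q) * inverse s)"

end

theory Submission
  imports Defs
begin

text \<open>
  The theorem rests on one identity for the linear part \<open>L v = p v s\<inverse>\<close> of \<open>T\<close>. Its adjoint is
  \<open>M w = cnj p \<cdot> w \<cdot> cnj (s\<inverse>)\<close>. Since \<open>\<psi> 3\<close> is orthogonal to the space \<open>\<A>\<close> spanned by
  \<open>\<psi> 0, \<psi> 1, \<psi> 2\<close>, which is the span of \<open>1, e\<^sub>1, e\<^sub>2\<close>, it is \<open>e\<^sub>3\<close> up to sign, and \<open>v \<mapsto> v \<psi>\<^sub>3\<close> turns
  \<open>\<A>\<close> into the purely imaginary quaternions. The condition linking \<open>s\<close> to \<open>p\<close> says that \<open>L\<close> and \<open>M\<close>
  are, in this picture, conjugations \<open>u \<mapsto> p u cnj p\<close> and \<open>u \<mapsto> cnj p u p\<close> up to positive factors;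
  so both preserve \<open>\<A>\<close> (lemma \<open>twisted_conjugation_in_psi_space\<close>).

  By the chain rule the Cauchy-Riemann operator applied to \<open>A\<^sub>T F \<circ> T\<close> is
  \<open>\<Sum>\<^sub>k \<psi>\<^sub>k A\<^sub>T F'(L \<psi>\<^sub>k)\<close>. Expanding \<open>L \<psi>\<^sub>k\<close> in the basis of \<open>\<A>\<close> and summing over \<open>k\<close> first moves \<open>L\<close>
  to its adjoint and gives \<open>\<Sum>\<^sub>j (M \<psi>\<^sub>j) A\<^sub>T F'(\<psi>\<^sub>j)\<close>. As \<open>s\<inverse> = \<bar>s\<inverse>\<bar> A\<^sub>T\<close> with \<open>A\<^sub>T\<close> a unit, the right
  factor of \<open>M\<close> cancels against \<open>A\<^sub>T\<close>, that is \<open>(M w) A\<^sub>T = B\<^sub>T w\<close>, and the sum is \<open>B\<^sub>T\<close> times the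
  Cauchy-Riemann operator of \<open>F\<close> at \<open>T x\<close> (lemma \<open>cauchy_riemann_affine\<close>). Both sides follow the
  same convention at points of non-differentiability, because \<open>T\<close> is an affine bijection of \<open>\<A>\<close>.

  This covariance is used twice. For the fractional integral of \<open>f\<close>, from which the constant left factor
  \<open>A\<^sub>T\<close> can be pulled out, it applies directly. For the scalar function \<open>\<lambda>\<^sub>0 + \<lambda>\<^sub>1 + \<lambda>\<^sub>2\<close> the factor
  \<open>A\<^sub>T\<close> commutes with the function and can be moved to the right of the operator, where it meets the
  integral of \<open>f\<close> (lemma \<open>cauchy_riemann_affine_real\<close>). The differential equation satisfied by
  the \<open>\<lambda>\<^sub>k\<close> then turns the sum of the two terms into the stated right-hand side.
\<close>

section \<open>Quaternion algebra\<close>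

lemma qcnj_sel [simp]:
  "re (qcnj x) = re x" "im1 (qcnj x) = - im1 x" "im2 (qcnj x) = - im2 x" "im3 (qcnj x) = - im3 x"
  by (simp_all add: qcnj_def)

lemma qcnj_mult: "qcnj (x * y) = qcnj y * qcnj (x :: 'a::comm_ring_1 quat)"
  by (simp add: quat_eq_iff algebra_simps)

lemma qcnj_qcnj [simp]: "qcnj (qcnj x) = x"
  by (simp add: quat_eq_iff)

lemma qcnj_scaleR: "qcnj (r *\<^sub>R x) = r *\<^sub>R qcnj (x :: 'a::real_vector quat)"
  by (simp add: quat_eq_iff)

lemma quat_of_real_sel [simp]:
  "re (of_real r :: 'a::{comm_ring_1,real_algebra_1} quat) = of_real r"
  "im1 (of_real r :: 'a quat) = 0" "im2 (of_real r :: 'a quat) = 0" "im3 (of_real r :: 'a quat) = 0"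
  by (simp_all add: of_real_def)

lemma norm_quat_square: "(norm x)\<^sup>2 = (re x)\<^sup>2 + (im1 x)\<^sup>2 + (im2 x)\<^sup>2 + (im3 x)\<^sup>2"
  for x :: "real quat"
  by (simp add: norm_quat_def)

lemma mult_qcnj: "x * qcnj x = of_real ((norm x)\<^sup>2)" for x :: "real quat"
  by (simp only: norm_quat_square) (simp add: quat_eq_iff power2_eq_square algebra_simps)

lemma qcnj_mult_self: "qcnj x * x = of_real ((norm x)\<^sup>2)" for x :: "real quat"
  by (simp only: norm_quat_square) (simp add: quat_eq_iff power2_eq_square algebra_simps)

lemma inner_sandwich: "(p * v * c) \<bullet> w = v \<bullet> (qcnj p * w * qcnj c)" for p v c w :: "real quat"
  by (simp add: inner_quat_def algebra_simps)

lemma of_real_mult_commute: "of_real r * x = x * (of_real r :: 'a::real_algebra_1)"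
  by (simp add: of_real_def)

lemma linear_quat_mult_left: "linear ((*) (c :: complex quat))"
  by (rule linearI) (simp_all add: distrib_left)

lemma linear_quat_mult_right: "linear (\<lambda>x. x * (c :: complex quat))"
  by (rule linearI) (simp_all add: distrib_right)

lemma complexify_sel [simp]:
  "re (complexify x) = complex_of_real (re x)" "im1 (complexify x) = complex_of_real (im1 x)"
  "im2 (complexify x) = complex_of_real (im2 x)" "im3 (complexify x) = complex_of_real (im3 x)"
  by (simp_all add: complexify_def quat.map_sel)

lemma complexify_mult: "complexify (x * y) = complexify x * complexify y"
  by (simp add: quat_eq_iff)

lemma complexify_one [simp]: "complexify 1 = 1"
  by (simp add: quat_eq_iff)

lemma complexify_scaleR: "complexify (r *\<^sub>R x) = r *\<^sub>R complexify x"
  by (simp add: quat_eq_iff scaleR_conv_of_real)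

lemma complexify_of_real: "complexify (of_real r) = of_real r"
  by (simp add: of_real_def complexify_scaleR)

lemma complexify_add: "complexify (x + y) = complexify x + complexify y"
  by (simp add: quat_eq_iff)

lemma complexify_sum: "complexify (\<Sum>i\<in>I. g i) = (\<Sum>i\<in>I. complexify (g i))"
proof (rule linear_sum)
  show "linear complexify"
    by (rule linearI) (simp_all add: complexify_add complexify_scaleR)
qed

section \<open>Geometry of the structural set\<close>

lemma sum_atMost3: "(\<Sum>k\<le>3. g k) = (\<Sum>k<3. g k) + g (3::nat)"
  by (metis lessThan_Suc_atMost eval_nat_numeral(3) sum.lessThan_Suc)

lemma orthonormal_expansion:
  assumes "orthonormal_quat_basis \<psi>"
  shows "x = (\<Sum>k\<le>3. (x \<bullet> \<psi> k) *\<^sub>R \<psi> k)"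
proof -
  define d where "d = x - (\<Sum>k\<le>3. (x \<bullet> \<psi> k) *\<^sub>R \<psi> k)"
  have on: "\<psi> k \<bullet> \<psi> s = (if k = s then 1 else 0)" if "k \<le> 3" "s \<le> 3" for k s
    using assms that by (auto simp: orthonormal_quat_basis_def)
  have "d \<bullet> \<psi> s = 0" if "s \<le> 3" for s
  proof -
    have "(\<Sum>k\<le>3. (x \<bullet> \<psi> k) * (\<psi> k \<bullet> \<psi> s)) = (\<Sum>k\<le>3. if k = s then x \<bullet> \<psi> k else 0)"
      by (rule sum.cong) (auto simp: on that)
    then show ?thesis
      using that by (simp add: d_def inner_diff_left inner_sum_left)
  qed
  moreover have "d \<in> span (\<psi> ` {..3})"
    using assms by (simp add: orthonormal_quat_basis_def)
  ultimately have "orthogonal d d"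
    by (intro orthogonal_to_span[of d "\<psi> ` {..3}" d]) (auto simp: orthogonal_def)
  then have "d = 0" by (simp only: orthogonal_self)
  then show ?thesis unfolding d_def by (simp only: right_minus_eq)
qed

lemma psi_space_iff_orthogonal:
  assumes "orthonormal_quat_basis \<psi>"
  shows "x \<in> psi_space \<psi> \<longleftrightarrow> x \<bullet> \<psi> 3 = 0"
proof
  have on: "\<psi> k \<bullet> \<psi> 3 = 0" if "k < 3" for k
    using assms that by (auto simp: orthonormal_quat_basis_def)
  assume "x \<in> psi_space \<psi>"
  then have "orthogonal (\<psi> 3) x"
    unfolding psi_space_def
    by (rule orthogonal_to_span) (auto simp: orthogonal_def inner_commute on)
  then show "x \<bullet> \<psi> 3 = 0" by (simp add: orthogonal_def inner_commute)
next
  assume "x \<bullet> \<psi> 3 = 0"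
  then have "x = (\<Sum>k<3. (x \<bullet> \<psi> k) *\<^sub>R \<psi> k)"
    using orthonormal_expansion[OF assms, of x] by (simp add: sum_atMost3)
  moreover have "(\<Sum>k<3. (x \<bullet> \<psi> k) *\<^sub>R \<psi> k) \<in> psi_space \<psi>"
    unfolding psi_space_def by (intro span_sum span_scale span_base) auto
  ultimately show "x \<in> psi_space \<psi>" by simp
qed

lemma psi_space_expansion:
  assumes "orthonormal_quat_basis \<psi>" "x \<in> psi_space \<psi>"
  shows "x = (\<Sum>k<3. (x \<bullet> \<psi> k) *\<^sub>R \<psi> k)"
  using orthonormal_expansion[OF assms(1), of x] assms psi_space_iff_orthogonal[OF assms(1)]
  by (simp add: sum_atMost3)

lemma psi_in_psi_space: "k < 3 \<Longrightarrow> \<psi> k \<in> psi_space \<psi>"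
  unfolding psi_space_def by (intro span_base) auto

text \<open>
  The unit \<open>e\<^sub>3\<close> is orthogonal to \<open>\<psi> 0, \<psi> 1, \<psi> 2\<close>, as these lie in the span of
  \<open>1, e\<^sub>1, e\<^sub>2\<close>, so only the last term remains of its
  expansion in the basis \<open>\<psi>\<close>.
\<close>

lemma psi3_eq:
  assumes "structural_set \<psi>" "orthonormal_quat_basis \<psi>"
  obtains r where "r * r = 1" "\<psi> 3 = Quat 0 0 0 r"
proof -
  define e3 :: "real quat" where "e3 = Quat 0 0 0 1"
  have "e3 \<bullet> \<psi> k = 0" if "k < 3" for k
  proof -
    have "\<psi> k \<in> span {1, qe1, qe2}"
      using assms(1) that by (auto simp: structural_set_def)
    then have "orthogonal e3 (\<psi> k)"
      by (rule orthogonal_to_span) (auto simp: orthogonal_def e3_def inner_quat_def)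
    then show ?thesis by (simp add: orthogonal_def)
  qed
  then have e3: "e3 = (e3 \<bullet> \<psi> 3) *\<^sub>R \<psi> 3"
    using orthonormal_expansion[OF assms(2), of e3] by (simp add: sum_atMost3)
  define r where "r = im3 (\<psi> 3)"
  have r: "e3 \<bullet> \<psi> 3 = r" by (simp add: e3_def r_def inner_quat_def)
  have "im3 e3 = r * r" using arg_cong[OF e3, of im3] by (simp add: r r_def)
  then have rr: "r * r = 1" by (simp add: e3_def)
  have "r *\<^sub>R e3 = (r * r) *\<^sub>R \<psi> 3" using e3 r by (metis scaleR_scaleR)
  then have "\<psi> 3 = Quat 0 0 0 r" by (simp add: rr) (simp add: e3_def quat_eq_iff)
  with rr that show thesis by blast
qed

lemma psi_space_iff_im3:
  assumes "structural_set \<psi>" "orthonormal_quat_basis \<psi>"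
  shows "x \<in> psi_space \<psi> \<longleftrightarrow> im3 x = 0"
proof -
  obtain r where "r * r = 1" "\<psi> 3 = Quat 0 0 0 r" using psi3_eq[OF assms] .
  then show ?thesis
    by (auto simp: psi_space_iff_orthogonal[OF assms(2)] inner_quat_def)
qed

text \<open>
  Right multiplication by \<open>\<psi> 3\<close> sends \<open>psi_space \<psi>\<close> onto the purely imaginary quaternions, which
  every map \<open>u \<mapsto> c * u * qcnj c\<close> preserves.
\<close>

lemma twisted_conjugation_in_psi_space:
  assumes "structural_set \<psi>" "orthonormal_quat_basis \<psi>" "v \<in> psi_space \<psi>"
  shows "c * v * (\<psi> 3 * qcnj c * qcnj (\<psi> 3)) \<in> psi_space \<psi>"
proof -
  obtain r where "r * r = 1" "\<psi> 3 = Quat 0 0 0 r" using psi3_eq[OF assms(1,2)] .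
  then show ?thesis
    using assms(3) by (simp add: psi_space_iff_im3[OF assms(1,2)] algebra_simps)
qed

lemma psi_subst_eq:
  assumes "orthonormal_quat_basis \<psi>" "x \<in> psi_space \<psi>" "k < 3"
  shows "psi_subst \<psi> x k t = x + (t - psi_coord \<psi> x k) *\<^sub>R \<psi> k"
proof -
  have "psi_subst \<psi> x k t
      = (\<Sum>j<3. (x \<bullet> \<psi> j) *\<^sub>R \<psi> j + (if j = k then (t - x \<bullet> \<psi> k) *\<^sub>R \<psi> k else 0))"
    unfolding psi_subst_def psi_point_def psi_coord_def
    by (rule sum.cong) (auto simp: scaleR_left_diff_distrib)
  also have "\<dots> = (\<Sum>j<3. (x \<bullet> \<psi> j) *\<^sub>R \<psi> j) + (t - x \<bullet> \<psi> k) *\<^sub>R \<psi> k"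
    using assms(3) by (simp add: sum.distrib)
  also have "\<dots> = x + (t - x \<bullet> \<psi> k) *\<^sub>R \<psi> k"
    using psi_space_expansion[OF assms(1,2)] by simp
  finally show ?thesis by (simp add: psi_coord_def)
qed

lemma psi_coord_psi_point:
  assumes "orthonormal_quat_basis \<psi>" "k < 3"
  shows "psi_coord \<psi> (psi_point \<psi> c) k = c k"
proof -
  have "psi_coord \<psi> (psi_point \<psi> c) k = (\<Sum>j<3. if j = k then c j else 0)"
    unfolding psi_point_def psi_coord_def inner_sum_left
    by (rule sum.cong) (use assms in \<open>auto simp: orthonormal_quat_basis_def\<close>)
  then show ?thesis using assms(2) by simp
qed

section \<open>The Cauchy-Riemann operator\<close>

lemma cauchy_riemann_eq:
  assumes "orthonormal_quat_basis \<psi>" "x \<in> psi_space \<psi>"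
    and F: "(F has_derivative F') (at x within psi_space \<psi>)"
  shows "cauchy_riemann \<psi> F x = (\<Sum>k<3. complexify (\<psi> k) * F' (\<psi> k))"
proof -
  have "vector_derivative (\<lambda>t. F (psi_subst \<psi> x k t)) (at (psi_coord \<psi> x k)) = F' (\<psi> k)"
    if k: "k < 3" for k
  proof -
    define l where "l = (\<lambda>t. x + (t - psi_coord \<psi> x k) *\<^sub>R \<psi> k)"
    have "l t \<in> psi_space \<psi>" for t
      unfolding l_def using assms(2) psi_in_psi_space[OF k]
      by (auto simp: psi_space_def intro: span_add span_scale)
    then have range: "range l \<subseteq> psi_space \<psi>" by auto
    have l: "(l has_derivative (\<lambda>h. h *\<^sub>R \<psi> k)) (at (psi_coord \<psi> x k))"
      unfolding l_def by (auto intro!: derivative_eq_intros)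
    have "(F has_derivative F') (at (l (psi_coord \<psi> x k)) within range l)"
      using has_derivative_subset[OF F range] by (simp add: l_def)
    from has_derivative_in_compose[OF l this]
    have "((\<lambda>t. F (l t)) has_derivative (\<lambda>h. F' (h *\<^sub>R \<psi> k))) (at (psi_coord \<psi> x k))" .
    moreover have "F' (h *\<^sub>R \<psi> k) = h *\<^sub>R F' (\<psi> k)" for h
      by (rule linear_scale[OF has_derivative_linear[OF F]])
    ultimately have "((\<lambda>t. F (l t)) has_vector_derivative F' (\<psi> k)) (at (psi_coord \<psi> x k))"
      by (simp add: has_vector_derivative_def)
    then show ?thesis
      by (simp add: psi_subst_eq[OF assms(1,2) k] l_def vector_derivative_at)
  qed
  moreover have "F differentiable (at x within psi_space \<psi>)"
    using F by (auto simp: differentiable_def)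
  ultimately show ?thesis by (simp add: cauchy_riemann_def)
qed

text \<open>The units \<open>\<psi> k\<close> multiply from the left, so the operator is linear over right multiplication.\<close>

lemma cauchy_riemann_mult_right:
  assumes "orthonormal_quat_basis \<psi>" "x \<in> psi_space \<psi>" and c: "c * c' = 1"
  shows "cauchy_riemann \<psi> (\<lambda>z. F z * c) x = cauchy_riemann \<psi> F x * c"
proof (cases "F differentiable (at x within psi_space \<psi>)")
  case True
  then obtain F' where F: "(F has_derivative F') (at x within psi_space \<psi>)"
    by (auto simp: differentiable_def)
  have "((\<lambda>z. F z * c) has_derivative (\<lambda>h. F' h * c)) (at x within psi_space \<psi>)"
    using linear_quat_mult_right F
    by (rule bounded_linear.has_derivative[OF linear_conv_bounded_linear[THEN iffD1]])
  then show ?thesis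
    by (simp only: cauchy_riemann_eq[OF assms(1,2) F] cauchy_riemann_eq[OF assms(1,2)]
        sum_distrib_right mult.assoc)
next
  case False
  have "F differentiable (at x within psi_space \<psi>)"
    if "(\<lambda>z. F z * c) differentiable (at x within psi_space \<psi>)"
  proof -
    from that obtain G where "((\<lambda>z. F z * c) has_derivative G) (at x within psi_space \<psi>)"
      by (auto simp: differentiable_def)
    with linear_quat_mult_right
    have "((\<lambda>z. F z * c * c') has_derivative (\<lambda>h. G h * c')) (at x within psi_space \<psi>)"
      by (rule bounded_linear.has_derivative[OF linear_conv_bounded_linear[THEN iffD1]])
    then show ?thesis by (auto simp: mult.assoc c differentiable_def)
  qed
  with False show ?thesis by (auto simp: cauchy_riemann_def)
qed

section \<open>Affine covariance of the Cauchy-Riemann operator\<close>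

text \<open>
  The unit quaternion \<open>A\<close> is the normalized right factor of the linear part of \<open>T\<close>; this is what
  lets it cancel against the adjoint of that linear part.
\<close>

lemma affine_transformation_factor:
  assumes "orthonormal_quat_basis \<psi>" "affine_transformation \<psi> p q s T"
    and A: "A = \<psi> 3 * (qcnj p /\<^sub>R norm p) * qcnj (\<psi> 3)"
  shows "inverse s = norm (inverse s) *\<^sub>R A" "norm (inverse s) \<noteq> 0" "qcnj A * A = 1" "A * qcnj A = 1"
proof -
  have s: "s \<noteq> 0" "p \<noteq> 0" using assms(2) by (auto simp: affine_transformation_def)
  then show n: "norm (inverse s) \<noteq> 0" by simp
  have "inverse s /\<^sub>R norm (inverse s) = A"
    using assms by (simp add: affine_transformation_def)
  then have sA: "A = inverse s /\<^sub>R norm (inverse s)" by simp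
  then show "inverse s = norm (inverse s) *\<^sub>R A" using n by simp
  have "norm A = 1" using n unfolding sA by simp
  then show "qcnj A * A = 1" "A * qcnj A = 1" by (simp_all add: qcnj_mult_self mult_qcnj)
qed

lemma psi_space_linear_part:
  assumes "structural_set \<psi>" "orthonormal_quat_basis \<psi>" "affine_transformation \<psi> p q s T"
    and v: "v \<in> psi_space \<psi>"
  shows "p * v * inverse s \<in> psi_space \<psi>" "qcnj p * v * qcnj (inverse s) \<in> psi_space \<psi>"
proof -
  define A where "A = \<psi> 3 * (qcnj p /\<^sub>R norm p) * qcnj (\<psi> 3)"
  define r where "r = norm (inverse s) / norm p"
  note tf = affine_transformation_factor[OF assms(2,3) A_def]
  have "inverse s = r *\<^sub>R (\<psi> 3 * qcnj p * qcnj (\<psi> 3))"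
    using tf(1) by (simp add: A_def r_def divide_inverse)
  then have e: "inverse s = r *\<^sub>R (\<psi> 3 * qcnj p * qcnj (\<psi> 3))"
      "qcnj (inverse s) = r *\<^sub>R (\<psi> 3 * qcnj (qcnj p) * qcnj (\<psi> 3))"
    by (simp_all add: qcnj_scaleR qcnj_mult mult.assoc)
  have sp: "r *\<^sub>R u \<in> psi_space \<psi>" if "u \<in> psi_space \<psi>" for u
    using that by (simp add: psi_space_def span_scale)
  show "p * v * inverse s \<in> psi_space \<psi>"
    unfolding e(1) mult_scaleR_right
    by (intro sp twisted_conjugation_in_psi_space[OF assms(1,2) v])
  show "qcnj p * v * qcnj (inverse s) \<in> psi_space \<psi>"
    unfolding e(2) mult_scaleR_right
    by (intro sp twisted_conjugation_in_psi_space[OF assms(1,2) v])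
qed

lemma has_derivative_affine:
  "((\<lambda>x. a * (x - u) * c + (d :: real quat)) has_derivative (\<lambda>h. a * h * c)) F"
proof -
  have "linear (\<lambda>h. a * h * c)"
    by (rule linearI) (simp_all add: distrib_left distrib_right)
  then have "((\<lambda>x. a * x * c) has_derivative (\<lambda>h. a * h * c)) F"
    by (intro bounded_linear_imp_has_derivative) (simp add: linear_conv_bounded_linear)
  then have "((\<lambda>x. a * x * c + (d - a * u * c)) has_derivative (\<lambda>h. a * h * c + 0)) F"
    by (intro has_derivative_add has_derivative_const)
  then show ?thesis by (simp add: algebra_simps)
qed

lemma affine_transformation_has_derivative:
  assumes "affine_transformation \<psi> p q s T"
  shows "(T has_derivative (\<lambda>h. p * h * inverse s)) F"
  using assms has_derivative_affine[of p 0 "inverse s" "q * inverse s" F]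
  by (simp add: affine_transformation_def distrib_right)

lemma affine_transformation_maps_psi_space:
  assumes "structural_set \<psi>" "orthonormal_quat_basis \<psi>" "affine_transformation \<psi> p q s T"
  shows "T ` psi_space \<psi> \<subseteq> psi_space \<psi>"
  using psi_space_linear_part(1)[OF assms] assms(3)
  by (auto simp: affine_transformation_def distrib_right psi_space_def intro: span_add)

text \<open>
  Composition with \<open>T\<close> does not change differentiability: \<open>T\<close> and its inverse
  \<open>y \<mapsto> p\<inverse> (y - q s\<inverse>) s\<close> both map \<open>psi_space \<psi>\<close> to itself. For the inverse this holds since its
  linear part is a multiple of the adjoint of the linear part of \<open>T\<close>.
\<close>

lemma differentiable_affine_iff:
  fixes K K' :: "complex quat \<Rightarrow> complex quat"
  assumes "structural_set \<psi>" "orthonormal_quat_basis \<psi>" and T: "affine_transformation \<psi> p q s T"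
    and K: "linear K" "\<And>w. K' (K w) = w" "linear K'"
  shows "(\<lambda>z. K (F (T z))) differentiable (at x within psi_space \<psi>) \<longleftrightarrow>
         F differentiable (at (T x) within psi_space \<psi>)"
proof -
  have ps: "p \<noteq> 0" "s \<noteq> 0" and q: "q * inverse s \<in> psi_space \<psi>"
    and Tdef: "T = (\<lambda>x. (p * x + q) * inverse s)"
    using T by (auto simp: affine_transformation_def)
  define S where "S = (\<lambda>y. inverse p * (y - q * inverse s) * s)"
  have ST: "S (T z) = z" for z
    using ps by (simp add: S_def Tdef distrib_right mult.assoc) (simp add: mult.assoc[symmetric])
  have TS: "T (S z) = z" for z
    using ps by (simp add: S_def Tdef distrib_right mult.assoc) (simp add: mult.assoc[symmetric])
  note Tspace = affine_transformation_maps_psi_space[OF assms(1-3)]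
  have inv: "inverse z = (qcnj z) /\<^sub>R (norm z)\<^sup>2" if "z \<noteq> 0" for z :: "real quat"
  proof -
    have "z * (qcnj z /\<^sub>R (norm z)\<^sup>2) = 1"
      using that by (simp add: mult_qcnj of_real_def)
    then show ?thesis by (metis inverse_unique)
  qed
  have Sspace: "S ` psi_space \<psi> \<subseteq> psi_space \<psi>"
  proof (rule image_subsetI)
    fix z assume z: "z \<in> psi_space \<psi>"
    have "s = inverse (inverse s)" using ps by simp
    also have "\<dots> = qcnj (inverse s) /\<^sub>R (norm (inverse s))\<^sup>2" by (rule inv) (use ps in simp)
    finally have "S z = inverse ((norm p)\<^sup>2) *\<^sub>R inverse ((norm (inverse s))\<^sup>2) *\<^sub>R
        (qcnj p * (z - q * inverse s) * qcnj (inverse s))"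
      unfolding S_def using inv[OF ps(1)]
      by (metis (no_types, lifting) mult_scaleR_left mult_scaleR_right)
    moreover have "z - q * inverse s \<in> psi_space \<psi>"
      using z q by (simp add: psi_space_def span_diff)
    ultimately show "S z \<in> psi_space \<psi>"
      using psi_space_linear_part(2)[OF assms(1-3)] by (simp add: psi_space_def span_scale)
  qed
  note T' = affine_transformation_has_derivative[OF T]
  have S': "(S has_derivative (\<lambda>h. inverse p * h * s)) net" for net
    using has_derivative_affine[of "inverse p" "q * inverse s" s 0 net] by (simp add: S_def)
  show ?thesis
  proof
    assume "F differentiable (at (T x) within psi_space \<psi>)"
    then obtain F' where "(F has_derivative F') (at (T x) within psi_space \<psi>)"
      by (auto simp: differentiable_def)
    from has_derivative_in_compose[OF T' has_derivative_subset[OF this Tspace]]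
    have "((\<lambda>z. F (T z)) has_derivative (\<lambda>h. F' (p * h * inverse s))) (at x within psi_space \<psi>)" .
    from bounded_linear.has_derivative[OF linear_conv_bounded_linear[THEN iffD1, OF K(1)] this]
    show "(\<lambda>z. K (F (T z))) differentiable (at x within psi_space \<psi>)"
      by (auto simp: differentiable_def)
  next
    assume "(\<lambda>z. K (F (T z))) differentiable (at x within psi_space \<psi>)"
    then obtain G where "((\<lambda>z. K (F (T z))) has_derivative G) (at x within psi_space \<psi>)"
      by (auto simp: differentiable_def)
    from bounded_linear.has_derivative[OF linear_conv_bounded_linear[THEN iffD1, OF K(3)] this]
    have "((\<lambda>z. F (T z)) has_derivative (\<lambda>h. K' (G h))) (at (S (T x)) within psi_space \<psi>)"
      by (simp add: K(2) ST)
    from has_derivative_in_compose[OF S' has_derivative_subset[OF this Sspace]]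
    show "F differentiable (at (T x) within psi_space \<psi>)"
      by (auto simp: TS differentiable_def)
  qed
qed

text \<open>
  The covariance of the operator: the chain rule, the adjoint of the linear part of \<open>T\<close>, and the
  cancellation of the right factor \<open>qcnj A\<close> of that adjoint against \<open>A\<close>.
\<close>

lemma cauchy_riemann_affine:
  assumes psi: "structural_set \<psi>" "orthonormal_quat_basis \<psi>"
    and T: "affine_transformation \<psi> p q s T"
    and A: "A = \<psi> 3 * (qcnj p /\<^sub>R norm p) * qcnj (\<psi> 3)"
    and x: "x \<in> psi_space \<psi>"
  shows "cauchy_riemann \<psi> (\<lambda>z. complexify A * F (T z)) x =
         complexify (norm (inverse s) *\<^sub>R qcnj p) * cauchy_riemann \<psi> F (T x)"
proof -
  (* The linear part L of T and its adjoint M for the inner product. *)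
  define L where "L = (\<lambda>v. p * v * inverse s)"
  define M where "M = (\<lambda>w. qcnj p * w * qcnj (inverse s))"
  define B where "B = norm (inverse s) *\<^sub>R qcnj p"
  note tf = affine_transformation_factor[OF psi(2) T A]
  note Tspace = affine_transformation_maps_psi_space[OF psi T]
  then have Tx: "T x \<in> psi_space \<psi>" using x by blast
  have "complexify (qcnj A) * (complexify A * w) = w" for w
    by (simp add: mult.assoc[symmetric] complexify_mult[symmetric] tf(3))
  from differentiable_affine_iff[OF psi T linear_quat_mult_left this linear_quat_mult_left]
  have diff: "(\<lambda>z. complexify A * F (T z)) differentiable (at x within psi_space \<psi>) \<longleftrightarrow>
      F differentiable (at (T x) within psi_space \<psi>)" .
  show ?thesis
  proof (cases "F differentiable (at (T x) within psi_space \<psi>)")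
    case False
    with diff show ?thesis by (simp add: cauchy_riemann_def)
  next
    case True
    then obtain F' where F: "(F has_derivative F') (at (T x) within psi_space \<psi>)"
      by (auto simp: differentiable_def)
    have lin: "linear F'" by (rule has_derivative_linear[OF F])
    have "(T has_derivative L) (at x within psi_space \<psi>)"
      unfolding L_def by (rule affine_transformation_has_derivative[OF T])
    from has_derivative_in_compose[OF this has_derivative_subset[OF F Tspace]]
    have "((\<lambda>z. F (T z)) has_derivative (\<lambda>h. F' (L h))) (at x within psi_space \<psi>)" .
    from bounded_linear.has_derivative[OF
        linear_conv_bounded_linear[THEN iffD1, OF linear_quat_mult_left] this]
    have FT: "((\<lambda>z. complexify A * F (T z)) has_derivative (\<lambda>h. complexify A * F' (L h)))
        (at x within psi_space \<psi>)" .
    have F'L: "F' (L (\<psi> k)) = (\<Sum>j<3. (\<psi> k \<bullet> M (\<psi> j)) *\<^sub>R F' (\<psi> j))" if "k < 3" for k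
    proof -
      have "L (\<psi> k) = (\<Sum>j<3. (L (\<psi> k) \<bullet> \<psi> j) *\<^sub>R \<psi> j)"
        unfolding L_def
        by (intro psi_space_expansion psi_space_linear_part(1)[OF psi T] psi psi_in_psi_space that)
      also have "\<dots> = (\<Sum>j<3. (\<psi> k \<bullet> M (\<psi> j)) *\<^sub>R \<psi> j)"
        by (simp add: L_def M_def inner_sandwich)
      finally show ?thesis by (simp only: linear_sum[OF lin] linear_scale[OF lin])
    qed
    have MA: "M w * A = B * w" for w
    proof -
      have "M w * A = (qcnj p * w) * (qcnj (norm (inverse s) *\<^sub>R A) * A)"
        unfolding M_def using tf(1) by (simp add: mult.assoc)
      also have "\<dots> = B * w"
        by (simp add: qcnj_scaleR tf(3) B_def)
      finally show ?thesis .
    qed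
    have adj: "(\<Sum>k<3. (\<psi> k \<bullet> M (\<psi> j)) *\<^sub>R (\<psi> k * A)) = B * \<psi> j" if "j < 3" for j
    proof -
      have "M (\<psi> j) \<in> psi_space \<psi>"
        unfolding M_def by (intro psi_space_linear_part(2)[OF psi T] psi_in_psi_space that)
      then have "M (\<psi> j) = (\<Sum>k<3. (\<psi> k \<bullet> M (\<psi> j)) *\<^sub>R \<psi> k)"
        by (subst inner_commute) (rule psi_space_expansion[OF psi(2)])
      then have "M (\<psi> j) * A = (\<Sum>k<3. (\<psi> k \<bullet> M (\<psi> j)) *\<^sub>R \<psi> k) * A" by simp
      then show ?thesis by (simp add: MA sum_distrib_right)
    qed
    have "cauchy_riemann \<psi> (\<lambda>z. complexify A * F (T z)) x
        = (\<Sum>k<3. complexify (\<psi> k) * (complexify A * F' (L (\<psi> k))))"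
      by (rule cauchy_riemann_eq[OF psi(2) x FT])
    also have "\<dots> = (\<Sum>k<3. \<Sum>j<3. complexify ((\<psi> k \<bullet> M (\<psi> j)) *\<^sub>R (\<psi> k * A)) * F' (\<psi> j))"
      by (intro sum.cong refl)
        (simp add: F'L sum_distrib_left complexify_scaleR complexify_mult mult.assoc)
    also have "\<dots> = (\<Sum>j<3. \<Sum>k<3. complexify ((\<psi> k \<bullet> M (\<psi> j)) *\<^sub>R (\<psi> k * A)) * F' (\<psi> j))"
      by (rule sum.swap)
    also have "\<dots> = (\<Sum>j<3. complexify (B * \<psi> j) * F' (\<psi> j))"
      by (intro sum.cong refl) (simp add: adj[symmetric] complexify_sum sum_distrib_right)
    also have "\<dots> = complexify B * cauchy_riemann \<psi> F (T x)"
      by (simp add: cauchy_riemann_eq[OF psi(2) Tx F] sum_distrib_left complexify_mult mult.assoc)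
    finally show ?thesis by (simp add: B_def)
  qed
qed

text \<open>
  A real-valued function commutes with \<open>A\<close>, so the factor can be taken out on the right, where the
  operator is linear.
\<close>

lemma cauchy_riemann_affine_real:
  assumes psi: "structural_set \<psi>" "orthonormal_quat_basis \<psi>"
    and T: "affine_transformation \<psi> p q s T"
    and A: "A = \<psi> 3 * (qcnj p /\<^sub>R norm p) * qcnj (\<psi> 3)"
    and x: "x \<in> psi_space \<psi>"
  shows "cauchy_riemann \<psi> (\<lambda>z. of_real (h (T z))) x * complexify A =
         complexify (norm (inverse s) *\<^sub>R qcnj p) * cauchy_riemann \<psi> (\<lambda>z. of_real (h z)) (T x)"
proof -
  have c: "complexify A * complexify (qcnj A) = 1"
    by (simp add: complexify_mult[symmetric] affine_transformation_factor(4)[OF psi(2) T A])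
  have "cauchy_riemann \<psi> (\<lambda>z. of_real (h (T z))) x * complexify A
      = cauchy_riemann \<psi> (\<lambda>z. of_real (h (T z)) * complexify A) x"
    by (rule cauchy_riemann_mult_right[OF psi(2) x c, symmetric])
  also have "\<dots> = cauchy_riemann \<psi> (\<lambda>z. complexify A * of_real (h (T z))) x"
    by (simp only: of_real_mult_commute)
  finally show ?thesis 
    by (simp only: cauchy_riemann_affine[OF assms, of "\<lambda>z. of_real (h z)"])
qed

section \<open>Fractional integrals\<close>

text \<open>
  A left factor with an inverse passes through the integral, also when the integral does not
  converge and has the default value 0.
\<close>

lemma frac_integral_mult_left:
  assumes c: "qcnj c * c = 1"
  shows "frac_integral l \<beta> \<rho> \<Phi> (\<lambda>t. c * u t) t = complexify c * frac_integral l \<beta> \<rho> \<Phi> u t"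
proof -
  define k where "k = (\<lambda>\<tau>. complex_of_real (exp ((\<rho> - 1) / \<rho> * (\<Phi> t - \<Phi> \<tau>))) *
                 complex_of_real (\<Phi> t - \<Phi> \<tau>) powr (\<beta> - 1))"
  define g where "g = (\<lambda>\<tau>. qscalar (k \<tau>) * complexify (u \<tau>) * of_real (deriv \<Phi> \<tau>))"
  have central: "qscalar z * (complexify c * w) = complexify c * (qscalar z * w)" for z w
    by (simp add: quat_eq_iff qscalar_def algebra_simps)
  have inv: "complexify (qcnj c) * (complexify c * w) = w" for w
    by (simp add: mult.assoc[symmetric] complexify_mult[symmetric] c)
  have "(LINT \<tau>:{l<..<t}|lborel. qscalar (k \<tau>) * complexify (c * u \<tau>) * of_real (deriv \<Phi> \<tau>))
      = (LINT \<tau>|lborel. complexify c * (indicat_real {l<..<t} \<tau> *\<^sub>R g \<tau>))"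
    unfolding set_lebesgue_integral_def g_def complexify_mult
    by (simp add: central mult.assoc)
  also have "\<dots> = complexify c * (LINT \<tau>|lborel. indicat_real {l<..<t} \<tau> *\<^sub>R g \<tau>)"
    by (rule integral_bounded_linear'[where T' = "(*) (complexify (qcnj c))"])
      (simp_all add: linear_quat_mult_left inv flip: linear_conv_bounded_linear)
  finally show ?thesis
    by (simp only: frac_integral_def k_def g_def set_lebesgue_integral_def central)
qed

lemma frac_integral3_mult_left:
  assumes "qcnj c * c = 1"
  shows "frac_integral3 \<psi> a \<beta> \<sigma> \<phi> (\<lambda>\<eta>. c * f \<eta>) \<xi> \<zeta> = complexify c * frac_integral3 \<psi> a \<beta> \<sigma> \<phi> f \<xi> \<zeta>"
  by (simp add: frac_integral3_def frac_integral_mult_left[OF assms] sum_distrib_left)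

section \<open>Covariance of the fractional operator\<close>

theorem theorem24:
  fixes \<psi> :: "nat \<Rightarrow> real quat"
    and a b \<sigma> :: "nat \<Rightarrow> real"
    and \<alpha> :: "nat \<Rightarrow> complex"
    and \<phi> :: "real quat \<Rightarrow> real"
    and \<Lambda> :: "nat \<Rightarrow> real quat \<Rightarrow> real"
    and p q s y A\<^sub>T B\<^sub>T :: "real quat"
    and T f :: "real quat \<Rightarrow> real quat"
    and \<Xi> :: "real quat set"
  assumes psi: "structural_set \<psi>" "\<psi> 0 = 1"
    and psi3: "orthonormal_quat_basis \<psi>" "cooriented \<psi>"
    and ab: "\<forall>k<3. a k < b k"
    and sigma: "\<forall>k<3. 0 < \<sigma> k \<and> \<sigma> k < 1"
    and alpha: "\<forall>k<3. 0 < Re (\<alpha> k) \<and> Re (\<alpha> k) < 1"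
    and T: "affine_transformation \<psi> p q s T"
    and Xi: "\<Xi> \<subseteq> psi_space \<psi>" "T ` \<Xi> = psi_box \<psi> a b"
    and y: "y \<in> \<Xi>"
    and phi: "C1_closed_box \<psi> a b \<phi>"
      "\<forall>i<3. \<forall>t\<in>{a i..b i}. phi_deriv \<psi> a b \<phi> (T y) i t > 0"
    and Lambda: "\<forall>k<3. C1_closed_box \<psi> a b (\<Lambda> k)"
      "\<forall>\<xi>\<in>psi_box \<psi> a b.
         cauchy_riemann \<psi> (\<lambda>\<eta>. of_real (\<Sum>k<3. \<Lambda> k \<eta>)) \<xi> =
         complexify (of_real (Dphi \<psi> a b \<phi> \<xi> (T y)) *
                     inverse (psi_point \<psi> \<sigma>) * (1 - psi_point \<psi> \<sigma>))"
    and A: "A\<^sub>T = \<psi> 3 * (qcnj p /\<^sub>R norm p) * qcnj (\<psi> 3)"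
    and B: "B\<^sub>T = norm (inverse s) *\<^sub>R qcnj p"
    and f: "AC1_box \<psi> a b f"
  shows "\<forall>x\<in>\<Xi>. \<forall>\<xi>. \<xi> = T x \<longrightarrow>
    frac_CR_affine \<psi> a \<alpha> \<sigma> \<phi> \<Lambda> T (\<lambda>\<eta>. A\<^sub>T * f \<eta>) x y * of_real (exp (\<Sum>k<3. \<Lambda> k (T x))) =
    complexify (B\<^sub>T * of_real (Dphi \<psi> a b \<phi> \<xi> (T y)) * inverse (psi_point \<psi> \<sigma>)) *
      frac_CR \<psi> a b \<alpha> \<sigma> \<phi> f \<xi> (T y) * of_real (exp (\<Sum>k<3. \<Lambda> k \<xi>))"
proof (intro ballI allI impI)
  fix x \<xi> assume xX: "x \<in> \<Xi>" and xi: "\<xi> = T x"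
  define I where "I = (\<lambda>\<eta>. frac_integral3 \<psi> a (\<lambda>i. 1 - \<alpha> i) \<sigma> \<phi> f \<eta> (T y))"
  define D where "D = Dphi \<psi> a b \<phi> \<xi> (T y)"
  define S where "S = psi_point \<psi> \<sigma>"
  have box: "\<xi> \<in> psi_box \<psi> a b" using Xi(2) xX xi by blast
  then obtain c where c: "\<xi> = psi_point \<psi> c" "\<forall>k<3. a k < c k \<and> c k < b k"
    by (auto simp: psi_box_def)
  have x: "x \<in> psi_space \<psi>" using xX Xi(1) by blast
  (* D > 0 is what allows the division by D in the fractional operator to be undone. *)
  have "phi_deriv \<psi> a b \<phi> (T y) i (psi_coord \<psi> \<xi> i) > 0" if "i < 3" for i
    using phi(2) c that by (simp add: psi_coord_psi_point[OF psi3(1)] less_imp_le)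
  then have "D > 0"
    unfolding D_def Dphi_def by (intro sum_pos) (auto simp: lessThan_empty_iff)
  then have D: "D \<noteq> 0" by simp
  have "psi_coord \<psi> S 0 = \<sigma> 0"
    unfolding S_def by (rule psi_coord_psi_point[OF psi3(1)]) simp
  then have "psi_coord \<psi> S 0 > 0" using sigma by simp
  then have "S \<noteq> 0" by (auto simp: psi_coord_def)
  then have S: "complexify (inverse S) * complexify S = 1"
    by (simp add: complexify_mult[symmetric])
  have unit: "qcnj A\<^sub>T * A\<^sub>T = 1" by (rule affine_transformation_factor(3)[OF psi3(1) T A])
  have int: "frac_integral3 \<psi> a (\<lambda>i. 1 - \<alpha> i) \<sigma> \<phi> (\<lambda>\<eta>. A\<^sub>T * f \<eta>) \<eta> (T y) = complexify A\<^sub>T * I \<eta>" for \<eta>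
    unfolding I_def by (rule frac_integral3_mult_left[OF unit])
  have "cauchy_riemann \<psi> (\<lambda>z. of_real (\<Sum>k<3. \<Lambda> k (T z))) x * (complexify A\<^sub>T * I \<xi>)
      = complexify B\<^sub>T * cauchy_riemann \<psi> (\<lambda>\<eta>. of_real (\<Sum>k<3. \<Lambda> k \<eta>)) \<xi> * I \<xi>"
    using cauchy_riemann_affine_real[OF psi(1) psi3(1) T A x, of "\<lambda>\<eta>. \<Sum>k<3. \<Lambda> k \<eta>"]
    by (simp add: mult.assoc[symmetric] B xi)
  also have "\<dots> = complexify B\<^sub>T * complexify (of_real D * inverse S * (1 - S)) * I \<xi>"
    using Lambda(2) box by (simp add: D_def S_def)
  finally have "frac_CR_affine \<psi> a \<alpha> \<sigma> \<phi> \<Lambda> T (\<lambda>\<eta>. A\<^sub>T * f \<eta>) x y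
      = complexify B\<^sub>T * complexify (of_real D * inverse S * (1 - S)) * I \<xi> +
        complexify B\<^sub>T * cauchy_riemann \<psi> I \<xi>"
    unfolding frac_CR_affine_def int
    by (simp add: xi cauchy_riemann_affine[OF psi(1) psi3(1) T A x] B)
  also have "complexify B\<^sub>T * cauchy_riemann \<psi> I \<xi>
      = complexify (B\<^sub>T * of_real D * inverse S) * (complexify S * (cauchy_riemann \<psi> I \<xi> /\<^sub>R D))"
  proof -
    have "complexify (B\<^sub>T * of_real D * inverse S) * (complexify S * (cauchy_riemann \<psi> I \<xi> /\<^sub>R D))
        = complexify (B\<^sub>T * of_real D) * (complexify (inverse S) * complexify S)
            * (cauchy_riemann \<psi> I \<xi> /\<^sub>R D)"
      by (simp only: complexify_mult mult.assoc)
    also have "\<dots> = complexify B\<^sub>T * cauchy_riemann \<psi> I \<xi>"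
      using D by (simp add: S complexify_mult complexify_of_real) (simp add: of_real_def)
    finally show ?thesis by simp
  qed
  finally have "frac_CR_affine \<psi> a \<alpha> \<sigma> \<phi> \<Lambda> T (\<lambda>\<eta>. A\<^sub>T * f \<eta>) x y
      = complexify (B\<^sub>T * of_real D * inverse S) *
          (complexify (1 - S) * I \<xi> + complexify S * (cauchy_riemann \<psi> I \<xi> /\<^sub>R D))"
    by (simp only: complexify_mult mult.assoc distrib_left)
  also have "\<dots> = complexify (B\<^sub>T * of_real D * inverse S) * frac_CR \<psi> a b \<alpha> \<sigma> \<phi> f \<xi> (T y)"
    by (simp only: frac_CR_def I_def D_def S_def)
  finally show "frac_CR_affine \<psi> a \<alpha> \<sigma> \<phi> \<Lambda> T (\<lambda>\<eta>. A\<^sub>T * f \<eta>) x y * of_real (exp (\<Sum>k<3. \<Lambda> k (T x))) =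
    complexify (B\<^sub>T * of_real (Dphi \<psi> a b \<phi> \<xi> (T y)) * inverse (psi_point \<psi> \<sigma>)) *
      frac_CR \<psi> a b \<alpha> \<sigma> \<phi> f \<xi> (T y) * of_real (exp (\<Sum>k<3. \<Lambda> k \<xi>))"
    by (simp only: xi D_def S_def)
qed

end
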